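(* Let $s>1$ and let $\phi:\mathbb{N}^*\to\mathbb{C}$ be a multiplicative function which is nonnegative or bounded. Suppose that $X$ follows the Zeta law of parameter $s$ and that $(N_i)_{i\ge 1}$ is a sequence of independent random variables such that, for every $i\ge1$, $1+N_i$ follows the geometric law $\mathcal{G}(1-p_i^{-s})$, where $(p_i)_{i\ge 1}$ is the sequence of prime numbers. Then $$\mathbb{E}[\phi(X)]=\prod_{i=1}^{+\infty}\mathbb{E}\left[\phi(p_i^{N_i})\right]$$ and $$\sum_{n=1}^{+\infty}\frac{\phi(n)}{n^s}=\prod_{i=1}^{+\infty}\left(\sum_{j=0}^{+\infty}p_i^{-sj}\phi(p_i^j)\right).$$ In particular, if $\phi$ is completely multiplicative, then $$\sum_{n=1}^{+\infty}\frac{\phi(n)}{n^s}=\prod_{i=1}^{+\infty}\left(1-p_i^{-s}\phi(p_i)\right)^{-1}.$$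
   Context: $\mathbb{N}^*=\{1,2,3,\dots\}$, and $(p_i)_{i\ge1}$ is the sequence of prime numbers. A function $\phi:\mathbb{N}^*\to\mathbb{C}$ is called multiplicative if $\phi(pq)=\phi(p)\phi(q)$ whenever $p$ and $q$ are coprime; it is called completely multiplicative if this holds for all pairs $(p,q)\in(\mathbb{N}^* )^2$. For $s>1$, the Zeta law of parameter $s$ is the probability on $\mathbb{N}^*$ assigning mass $\frac{n^{-s}}{\zeta(s)}$ to each point $n$, where $\zeta(s)=\sum_{k=1}^{+\infty}k^{-s}$. The geometric law $\mathcal{G}(p)$, $p\in(0,1)$, is the law on $\mathbb{N}^*$ giving mass $p(1-p)^{k-1}$ to $k$; thus $\mathbb{P}(N_i=j)=(1-p_i^{-s})p_i^{-sj}$ for every integer $j\ge0$.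
   Formalization: In the third formula φ is assumed not identically zero (for φ = 0 it would read 0 = 1), and for nonnegative φ a factor with p_i^{-s}φ(p_i) ≥ 1, where the written inverse is undefined or negative but the series diverges, is read as +∞. *)

theory Defs
  imports "HOL-Probability.Probability" "HOL-Computational_Algebra.Primes"
begin

text \<open>Functions on the positive integers are functions on \<^typ>\<open>nat\<close> whose value at \<open>0\<close> is
  never used. As in the source, multiplicativity does not include \<open>\<phi> 1 = 1\<close>, so the zero function
  is both multiplicative and completely multiplicative.\<close>

definition multiplicative_fun :: "(nat \<Rightarrow> complex) \<Rightarrow> bool" where
  "multiplicative_fun \<phi> \<longleftrightarrow>
     (\<forall>m\<ge>1. \<forall>n\<ge>1. coprime m n \<longrightarrow> \<phi> (m * n) = \<phi> m * \<phi> n)"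

definition completely_multiplicative_fun :: "(nat \<Rightarrow> complex) \<Rightarrow> bool" where
  "completely_multiplicative_fun \<phi> \<longleftrightarrow> (\<forall>m\<ge>1. \<forall>n\<ge>1. \<phi> (m * n) = \<phi> m * \<phi> n)"

definition nonnegative_fun :: "(nat \<Rightarrow> complex) \<Rightarrow> bool" where
  "nonnegative_fun \<phi> \<longleftrightarrow> (\<forall>n\<ge>1. \<phi> n \<in> \<real>\<^sub>\<ge>\<^sub>0)"

definition bounded_fun :: "(nat \<Rightarrow> complex) \<Rightarrow> bool" where
  "bounded_fun \<phi> \<longleftrightarrow> bounded (\<phi> ` {1..})"

text \<open>The increasing sequence of primes, indexed from \<open>0\<close>: \<open>nth_prime 0 = 2\<close>.\<close>

definition nth_prime :: "nat \<Rightarrow> nat" where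
  "nth_prime i = enumerate {p. prime p} i"

definition zeta :: "real \<Rightarrow> real" where
  "zeta s = (\<Sum>k. real (Suc k) powr (- s))"

definition zeta_mass :: "real \<Rightarrow> nat \<Rightarrow> real" where
  "zeta_mass s n = real n powr (- s) / zeta s"

definition geometric_mass :: "real \<Rightarrow> nat \<Rightarrow> real" where
  "geometric_mass p k = p * (1 - p) ^ (k - 1)"

text \<open>\<open>Y\<close> takes values in the positive integers, and its law gives mass \<open>w n\<close> to each \<open>n \<ge> 1\<close>.\<close>

definition has_law :: "'a measure \<Rightarrow> ('a \<Rightarrow> nat) \<Rightarrow> (nat \<Rightarrow> real) \<Rightarrow> bool" where
  "has_law M Y w \<longleftrightarrow> distributed M (count_space {1..}) Y (\<lambda>n. ennreal (w n))"

text \<open>An infinite product is the limit of its partial products. The library's \<open>has_prod\<close>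
  additionally excludes products with infinitely many zero factors, which do occur here
  (for \<open>\<phi> = 0\<close>).\<close>

definition infinite_product ::
    "(nat \<Rightarrow> 'a::{topological_space, comm_monoid_mult}) \<Rightarrow> 'a \<Rightarrow> bool" where
  "infinite_product f x \<longleftrightarrow> (\<lambda>n. \<Prod>i<n. f i) \<longlonglongrightarrow> x"

text \<open>For nonnegative \<open>\<phi>\<close> the identities are stated in \<open>[0, \<infinity>]\<close>. In \<^typ>\<open>ennreal\<close>,
  subtraction is truncated and \<open>inverse 0 = \<infinity>\<close>, so \<open>inverse (1 - ennreal x)\<close> is \<open>1 / (1 - x)\<close>
  for \<open>0 \<le> x < 1\<close> and \<open>\<infinity>\<close> for \<open>x \<ge> 1\<close>: the value of the geometric series with ratio \<open>x\<close>.
  The formula for completely multiplicative \<open>\<phi>\<close> fails for \<open>\<phi> = 0\<close> (the left side is \<open>0\<close>, the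
  right side is \<open>1\<close>), so there \<open>\<phi>\<close> is required not to vanish identically.\<close>

end

theory Submission
  imports Defs
begin

text \<open>
  Let \<open>Y n\<close> be the product of \<open>nth_prime i ^ N i\<close> over \<open>i < n\<close> (\<open>partial_prod\<close> below). It takes the
  value \<open>m\<close> exactly when \<open>m\<close> has no prime factor besides the first \<open>n\<close> primes (\<open>m\<close> is smooth) and
  each \<open>N i\<close> is the multiplicity of \<open>nth_prime i\<close> in \<open>m\<close>. By independence the powers of the primes
  multiply up to \<open>m powr -s\<close>, so \<open>Y n\<close> has mass \<open>c n * m powr -s\<close> at each smooth \<open>m\<close>, where \<open>c n\<close>
  (\<open>norm_const\<close> below) is the product of \<open>1 - nth_prime i powr -s\<close> over \<open>i < n\<close>. In other words,
  \<open>Y n\<close> follows the Zeta law conditioned on smoothness (lemma \<open>partial_prod_law\<close>).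

  The expectation of \<open>\<phi> (Y n)\<close> can now be computed in two ways. Multiplicativity and independence
  turn it into the \<open>n\<close>-th partial product of the expectations of \<open>\<phi> (nth_prime i ^ N i)\<close>, and the
  law of \<open>Y n\<close> turns it into \<open>c n\<close> times the sum of \<open>\<phi> m * m powr -s\<close> over smooth \<open>m\<close>. Every \<open>m > 0\<close>
  is smooth for all large \<open>n\<close>, so this sum tends to the full Dirichlet series, by monotone
  convergence for \<open>\<phi> \<ge> 0\<close> and by dominated convergence for bounded \<open>\<phi>\<close>. With \<open>\<phi> = 1\<close> the same
  identity says that \<open>c n\<close> is the inverse of the sum of \<open>m powr -s\<close> over smooth \<open>m\<close>, and hence
  that \<open>c n\<close> tends to \<open>1 / zeta s\<close>. Keeping \<open>c n\<close> yields the product formula for the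
  expectations; cancelling it yields the Euler product (lemmas \<open>euler_product_ennreal\<close> and
  \<open>euler_product_complex\<close>). For completely multiplicative \<open>\<phi>\<close> the factors are geometric series.

  The factorisation of \<open>\<phi> (Y n)\<close> is used for \<open>n > 0\<close> only: \<open>\<phi> 1\<close> may be \<open>0\<close>, and then it fails
  for the empty product.
\<close>

section \<open>The Zeta series and the sequence of primes\<close>

lemma summable_zeta: "s > 1 \<Longrightarrow> summable (\<lambda>k. real (Suc k) powr (- s))"
  using summable_real_powr_iff[of "- s"] by (subst summable_Suc_iff) simp

lemma zeta_pos: "s > 1 \<Longrightarrow> zeta s > 0"
  unfolding zeta_def by (rule suminf_pos[OF summable_zeta]) auto

lemma bij_nth_prime: "bij_betw nth_prime UNIV {p. prime p}"
  using bij_enumerate[OF primes_infinite] by (simp add: nth_prime_def[abs_def])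

lemma prime_nth_prime [simp]: "prime (nth_prime i)"
  using bij_betwE[OF bij_nth_prime] by auto

lemma nth_prime_eq_iff [simp]: "nth_prime i = nth_prime j \<longleftrightarrow> i = j"
  using bij_nth_prime by (auto simp: bij_betw_def inj_eq)

lemma nth_prime_pos [simp]: "nth_prime i > 0"
  by (simp add: prime_gt_0_nat)

lemma nth_prime_powr_bounds:
  assumes "s > 1"
  shows "0 < real (nth_prime i) powr (- s)" "real (nth_prime i) powr (- s) < 1"
proof -
  have "nth_prime i > 1" by (rule prime_gt_1_nat) simp
  then show "0 < real (nth_prime i) powr (- s)" "real (nth_prime i) powr (- s) < 1"
    using assms powr_less_one[of "real (nth_prime i)" "-s"] by auto
qed

lemma powr_mult_nat: "x > 0 \<Longrightarrow> x powr (- (s * real j)) = (x powr (- s)) ^ j"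
  by (simp add: powr_powr flip: powr_realpow)

section \<open>Smooth numbers and unique factorisation\<close>

definition smooth :: "nat \<Rightarrow> nat \<Rightarrow> bool" where
  "smooth n m \<longleftrightarrow> prime_factors m \<subseteq> nth_prime ` {..<n}"

lemma smooth_mono: "smooth n m \<Longrightarrow> n \<le> n' \<Longrightarrow> smooth n' m"
  unfolding smooth_def by (erule order_trans) (intro image_mono, simp)

lemma eventually_smooth: "eventually (\<lambda>n. smooth n m) sequentially"
proof -
  have "prime_factors m \<subseteq> range nth_prime"
    using bij_nth_prime by (auto simp: bij_betw_def)
  then obtain I where I: "finite I" "prime_factors m = nth_prime ` I"
    by (meson finite_set_mset finite_subset_image)
  from \<open>finite I\<close> obtain b where "\<forall>i\<in>I. i < b"
    using finite_nat_set_iff_bounded by auto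
  then have "smooth b m" using I by (auto simp: smooth_def)
  then show ?thesis
    by (auto simp: eventually_sequentially intro: smooth_mono)
qed

lemma smooth_decompose:
  assumes "m > 0" "smooth n m"
  shows "(\<Prod>i<n. nth_prime i ^ multiplicity (nth_prime i) m) = m"
proof -
  have "(\<Prod>i<n. nth_prime i ^ multiplicity (nth_prime i) m)
      = (\<Prod>p\<in>nth_prime ` {..<n}. p ^ multiplicity p m)"
    by (subst prod.reindex) (auto simp: inj_on_def)
  also have "\<dots> = (\<Prod>p\<in>prime_factors m. p ^ multiplicity p m)"
    using assms by (intro prod.mono_neutral_right)
      (auto simp: smooth_def prime_factors_multiplicity)
  also have "\<dots> = m" using assms by (simp add: prod_prime_factors)
  finally show ?thesis .
qed

lemma multiplicity_nth_prime_prod: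
  assumes "i < n"
  shows "multiplicity (nth_prime i) (\<Prod>j<n. nth_prime j ^ f j) = f i"
proof -
  \<comment> \<open>the exponents, indexed by the primes themselves instead of their positions\<close>
  define h where "h = f \<circ> inv nth_prime"
  have inj: "inj nth_prime" by (auto simp: inj_on_def)
  have "(\<Prod>j<n. nth_prime j ^ f j) = (\<Prod>p\<in>nth_prime ` {..<n}. p ^ h p)"
    using inj by (subst prod.reindex) (auto simp: inj_on_def h_def)
  also have "multiplicity (nth_prime i) \<dots> = h (nth_prime i)"
    using assms by (subst multiplicity_prod_prime_powers) auto
  finally show ?thesis using inj by (simp add: h_def)
qed

lemma smooth_prod: "smooth n (\<Prod>i<n. nth_prime i ^ f i)"
proof -
  have "p \<in> nth_prime ` {..<n}" if p: "prime p" "p dvd (\<Prod>i<n. nth_prime i ^ f i)" for p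
  proof -
    obtain i where i: "i < n" "p dvd nth_prime i ^ f i"
      using p by (auto simp: prime_dvd_prod_iff)
    then have "p dvd nth_prime i" using p(1) prime_dvd_power by blast
    then have "p = nth_prime i" using p(1) by (simp add: primes_dvd_imp_eq)
    then show ?thesis using i by auto
  qed
  then show ?thesis by (auto simp: smooth_def prime_factors_dvd)
qed

text \<open>Unique factorisation, in the form that translates an event for the product of random prime
  powers into events for the single exponents.\<close>

lemma prod_nth_prime_power_eq_iff:
  assumes "m > 0"
  shows "(\<Prod>i<n. nth_prime i ^ f i) = m
    \<longleftrightarrow> smooth n m \<and> (\<forall>i<n. f i = multiplicity (nth_prime i) m)"
proof (intro iffI conjI)
  assume "(\<Prod>i<n. nth_prime i ^ f i) = m"
  then show "smooth n m" "\<forall>i<n. f i = multiplicity (nth_prime i) m"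
    by (auto simp: smooth_prod multiplicity_nth_prime_prod)
next
  assume "smooth n m \<and> (\<forall>i<n. f i = multiplicity (nth_prime i) m)"
  then show "(\<Prod>i<n. nth_prime i ^ f i) = m"
    using smooth_decompose[of m n] assms by simp
qed

text \<open>The product is over \<open>Suc n\<close> factors because \<open>g 1 = 1\<close> need not hold.\<close>

lemma multiplicative_prod_nth_prime:
  fixes g :: "nat \<Rightarrow> 'b::comm_monoid_mult"
  assumes "\<And>a b. a \<ge> 1 \<Longrightarrow> b \<ge> 1 \<Longrightarrow> coprime a b \<Longrightarrow> g (a * b) = g a * g b"
  shows "g (\<Prod>i<Suc n. nth_prime i ^ f i) = (\<Prod>i<Suc n. g (nth_prime i ^ f i))"
proof (induction n)
  case (Suc n)
  have "coprime (\<Prod>i<Suc n. nth_prime i ^ f i) (nth_prime (Suc n) ^ f (Suc n))"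
    by (intro prod_coprime_left coprime_power_left_iff[THEN iffD2] impI
         coprime_power_right_iff[THEN iffD2] disjI1 primes_coprime) auto
  moreover have "(\<Prod>i<Suc n. nth_prime i ^ f i) \<ge> 1" "nth_prime (Suc n) ^ f (Suc n) \<ge> 1"
    by (auto simp: Suc_le_eq intro!: prod_pos)
  ultimately show ?case
    using Suc assms by (subst (1 2) prod.lessThan_Suc) metis
qed simp

section \<open>Laws on the positive integers\<close>

lemma has_law_nn_integral:
  assumes "has_law M Y w"
  shows "(\<integral>\<^sup>+\<omega>. g (Y \<omega>) \<partial>M) = (\<Sum>k. ennreal (w (Suc k)) * g (Suc k))"
proof -
  have "(\<integral>\<^sup>+\<omega>. g (Y \<omega>) \<partial>M) = (\<integral>\<^sup>+k. ennreal (w k) * g k \<partial>count_space {1..})"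
    using assms by (intro distributed_nn_integral[symmetric]) (auto simp: has_law_def)
  also have "\<dots> = (\<integral>\<^sup>+k. ennreal (w (Suc k)) * g (Suc k) \<partial>count_space UNIV)"
    by (rule nn_integral_bij_count_space[symmetric])
       (auto simp: bij_betw_def image_iff Suc_le_eq gr0_conv_Suc)
  finally show ?thesis by (simp add: nn_integral_count_space_nat)
qed

lemma (in prob_space) has_law_integral:
  fixes f :: "nat \<Rightarrow> 'b::{banach, second_countable_topology}"
  assumes law: "has_law M Y w" and w: "\<And>k. k \<ge> 1 \<Longrightarrow> w k \<ge> 0"
    and bd: "\<And>k. k \<ge> 1 \<Longrightarrow> norm (f k) \<le> B"
  shows "integrable M (\<lambda>\<omega>. f (Y \<omega>))"
    and "(\<lambda>k. w (Suc k) *\<^sub>R f (Suc k)) sums (\<integral>\<omega>. f (Y \<omega>) \<partial>M)"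
proof -
  have Y [measurable]: "Y \<in> measurable M (count_space {1..})"
    and distr: "distr M (count_space {1..}) Y = density (count_space {1..}) (\<lambda>k. ennreal (w k))"
    using law by (auto simp: has_law_def distributed_def)
  have f: "f \<in> borel_measurable (count_space {1..})" by simp
  have ge1: "Y \<omega> \<ge> 1" if "\<omega> \<in> space M" for \<omega>
    using measurable_space[OF Y that] by simp
  show int: "integrable M (\<lambda>\<omega>. f (Y \<omega>))"
    using bd ge1 by (intro integrable_const_bound[of _ B] measurable_compose[OF Y f]) auto
  have nn: "AE k in count_space {1..}. 0 \<le> w k" using w by (auto simp: AE_count_space)
  have "integrable (distr M (count_space {1..}) Y) f"
    using int by (subst integrable_distr_eq[OF Y f])
  then have i1: "integrable (count_space {1..}) (\<lambda>k. w k *\<^sub>R f k)"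
    unfolding distr using nn by (subst (asm) integrable_density) auto
  have bij: "bij_betw Suc UNIV {1..}"
    by (auto simp: bij_betw_def image_iff Suc_le_eq gr0_conv_Suc)
  have "integrable (count_space UNIV) (\<lambda>k. w (Suc k) *\<^sub>R f (Suc k))"
    using i1 by (subst integrable_bij_count_space[OF bij])
  then have "(\<lambda>k. w (Suc k) *\<^sub>R f (Suc k)) sums
      (\<integral>k. w (Suc k) *\<^sub>R f (Suc k) \<partial>count_space UNIV)"
    by (rule sums_integral_count_space_nat)
  also have "(\<integral>k. w (Suc k) *\<^sub>R f (Suc k) \<partial>count_space UNIV)
      = (\<integral>k. w k *\<^sub>R f k \<partial>count_space {1..})"
    by (rule integral_bij_count_space[OF bij])
  also have "\<dots> = integral\<^sup>L (distr M (count_space {1..}) Y) f"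
    unfolding distr using nn by (subst integral_density) auto
  also have "\<dots> = (\<integral>\<omega>. f (Y \<omega>) \<partial>M)" by (rule integral_distr[OF Y f])
  finally show "(\<lambda>k. w (Suc k) *\<^sub>R f (Suc k)) sums (\<integral>\<omega>. f (Y \<omega>) \<partial>M)" .
qed

lemma has_law_emeasure:
  assumes "has_law M Y w" "k \<ge> 1"
  shows "emeasure M (Y -` {k} \<inter> space M) = ennreal (w k)"
proof -
  have Y: "Y \<in> measurable M (count_space {1..})"
    and distr: "distr M (count_space {1..}) Y = density (count_space {1..}) (\<lambda>k. ennreal (w k))"
    using assms by (auto simp: has_law_def distributed_def)
  have "emeasure M (Y -` {k} \<inter> space M) = emeasure (distr M (count_space {1..}) Y) {k}"
    using Y assms by (subst emeasure_distr) auto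
  also have "\<dots> = ennreal (w k)"
    unfolding distr using assms by (subst emeasure_density) (auto simp: nn_integral_indicator_singleton')
  finally show ?thesis .
qed

lemma has_lawI:
  assumes Y: "Y \<in> measurable M (count_space {1..})"
    and eq: "\<And>k. k \<ge> 1 \<Longrightarrow> emeasure M (Y -` {k} \<inter> space M) = ennreal (w k)"
  shows "has_law M Y w"
proof -
  have "distr M (count_space {1..}) Y = density (count_space {1..}) (\<lambda>k. ennreal (w k))"
  proof (rule measure_eqI_countable[of _ "{1..}"])
    fix k :: nat assume k: "k \<in> {1..}"
    then show "emeasure (distr M (count_space {1..}) Y) {k}
        = emeasure (density (count_space {1..}) (\<lambda>k. ennreal (w k))) {k}"
      using Y eq[of k] by (subst emeasure_distr, simp, simp, subst emeasure_density)
        (auto simp: nn_integral_indicator_singleton')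
  qed auto
  then show ?thesis using Y by (auto simp: has_law_def distributed_def)
qed


section \<open>Dirichlet series over smooth numbers\<close>

definition smooth_weight :: "real \<Rightarrow> nat \<Rightarrow> nat \<Rightarrow> real" where
  "smooth_weight s n m = (if smooth n m then real m powr (- s) else 0)"

lemma smooth_weight_nonneg [simp]: "smooth_weight s n m \<ge> 0"
  by (simp add: smooth_weight_def)

lemma smooth_weight_le: "smooth_weight s n m \<le> real m powr (- s)"
  by (simp add: smooth_weight_def)

lemma smooth_weight_mono: "n \<le> n' \<Longrightarrow> smooth_weight s n m \<le> smooth_weight s n' m"
  by (auto simp: smooth_weight_def smooth_mono)

lemma eventually_smooth_weight:
  "eventually (\<lambda>n. smooth_weight s n m = real m powr (- s)) sequentially"
  using eventually_smooth[of m] by eventually_elim (simp add: smooth_weight_def)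

text \<open>Monotone convergence: the weights increase with \<open>n\<close> and are eventually equal to their limits.\<close>

lemma suminf_smooth_weight_tendsto_ennreal:
  fixes g :: "nat \<Rightarrow> ennreal"
  shows "(\<lambda>n. \<Sum>k. ennreal (smooth_weight s n (Suc k)) * g (Suc k))
      \<longlonglongrightarrow> (\<Sum>k. ennreal (real (Suc k) powr (- s)) * g (Suc k))"
proof -
  define a where "a n k = ennreal (smooth_weight s n (Suc k)) * g (Suc k)" for n k
  have inc: "incseq (\<lambda>n. a n k)" for k
    by (auto simp: a_def incseq_def intro!: mult_right_mono ennreal_leI smooth_weight_mono)
  have "(\<lambda>n. a n k) \<longlonglongrightarrow> ennreal (real (Suc k) powr (- s)) * g (Suc k)" for k
    using eventually_smooth_weight[of s "Suc k"]
    by (intro tendsto_eventually) (auto simp: a_def elim!: eventually_mono)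
  then have "(SUP n. a n k) = ennreal (real (Suc k) powr (- s)) * g (Suc k)" for k
    using LIMSEQ_SUP[OF inc] LIMSEQ_unique by blast
  moreover have "incseq (\<lambda>n. \<Sum>k. a n k)"
    using inc by (auto simp: incseq_def intro!: suminf_le)
  ultimately show ?thesis
    using LIMSEQ_SUP[of "\<lambda>n. \<Sum>k. a n k"] ennreal_suminf_SUP_eq[of a, OF inc]
    by (simp add: a_def)
qed

text \<open>Dominated convergence, with \<open>B\<close> times the Zeta series as dominating series.\<close>

lemma suminf_smooth_weight_tendsto:
  fixes f :: "nat \<Rightarrow> 'b::{real_normed_algebra, banach}"
  assumes s: "s > 1" and bd: "\<And>k. k \<ge> 1 \<Longrightarrow> norm (f k) \<le> B"
  shows "summable (\<lambda>k. real (Suc k) powr (- s) *\<^sub>R f (Suc k))"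
    and "(\<lambda>n. \<Sum>k. smooth_weight s n (Suc k) *\<^sub>R f (Suc k))
      \<longlonglongrightarrow> (\<Sum>k. real (Suc k) powr (- s) *\<^sub>R f (Suc k))"
proof -
  have B: "summable (\<lambda>k. real (Suc k) powr (- s) * B)"
    using summable_zeta[OF s] by (rule summable_mult2)
  have *: "(\<lambda>n. smooth_weight s n (Suc k) *\<^sub>R f (Suc k)) \<longlonglongrightarrow> real (Suc k) powr (- s) *\<^sub>R f (Suc k)" for k
    using eventually_smooth_weight[of s "Suc k"]
    by (intro tendsto_eventually) (auto elim!: eventually_mono)
  have bound: "eventually (\<lambda>(k, n). norm (smooth_weight s n (Suc k) *\<^sub>R f (Suc k))
      \<le> real (Suc k) powr (- s) * B) (sequentially \<times>\<^sub>F sequentially)"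
    using bd smooth_weight_le[of s]
    by (intro always_eventually) (auto intro!: mult_mono simp del: of_nat_Suc)
  have "summable (\<lambda>k. norm (real (Suc k) powr (- s) *\<^sub>R f (Suc k))) \<and>
     (\<lambda>n. \<Sum>k. smooth_weight s n (Suc k) *\<^sub>R f (Suc k))
      \<longlonglongrightarrow> (\<Sum>k. real (Suc k) powr (- s) *\<^sub>R f (Suc k))"
    using tannerys_theorem[OF * bound B sequentially_bot] by blast
  then show "summable (\<lambda>k. real (Suc k) powr (- s) *\<^sub>R f (Suc k))"
    "(\<lambda>n. \<Sum>k. smooth_weight s n (Suc k) *\<^sub>R f (Suc k))
      \<longlonglongrightarrow> (\<Sum>k. real (Suc k) powr (- s) *\<^sub>R f (Suc k))"
    by (blast intro: summable_norm_cancel)+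
qed

section \<open>Products of independent prime powers\<close>

locale zeta_exponents = prob_space M for M :: "'a measure" +
  fixes s :: real and N :: "nat \<Rightarrow> 'a \<Rightarrow> nat"
  assumes s_gt_1: "s > 1"
    and indep: "indep_vars (\<lambda>_. count_space UNIV) N UNIV"
    and law: "\<And>i. has_law M (\<lambda>\<omega>. 1 + N i \<omega>) (geometric_mass (1 - real (nth_prime i) powr (- s)))"
begin

definition norm_const :: "nat \<Rightarrow> real" where
  "norm_const n = (\<Prod>i<n. 1 - real (nth_prime i) powr (- s))"

definition partial_prod :: "nat \<Rightarrow> 'a \<Rightarrow> nat" where
  "partial_prod n \<omega> = (\<Prod>i<n. nth_prime i ^ N i \<omega>)"

lemma factor_pos: "1 - real (nth_prime i) powr (- s) > 0"
  using nth_prime_powr_bounds[OF s_gt_1, of i] by simp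

lemma norm_const_pos: "norm_const n > 0"
  unfolding norm_const_def by (intro prod_pos ballI factor_pos)

lemma geometric_mass_Suc:
  "geometric_mass (1 - real (nth_prime i) powr (- s)) (Suc j)
     = (1 - real (nth_prime i) powr (- s)) * real (nth_prime i) powr (- (s * real j))"
  by (simp add: geometric_mass_def powr_mult_nat)

lemma N_measurable [measurable]: "N i \<in> measurable M (count_space UNIV)"
  using indep by (auto simp: indep_vars_def)

lemma partial_prod_pos: "partial_prod n \<omega> \<ge> 1"
  by (auto simp: partial_prod_def Suc_le_eq intro!: prod_pos)

lemma prob_N:
  "prob (N i -` {j} \<inter> space M)
     = (1 - real (nth_prime i) powr (- s)) * real (nth_prime i) powr (- (s * real j))"
proof -
  have "N i -` {j} \<inter> space M = (\<lambda>\<omega>. 1 + N i \<omega>) -` {Suc j} \<inter> space M" by auto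
  then have "emeasure M (N i -` {j} \<inter> space M)
     = ennreal ((1 - real (nth_prime i) powr (- s)) * real (nth_prime i) powr (- (s * real j)))"
    using has_law_emeasure[OF law[of i], of "Suc j"] by (simp add: geometric_mass_Suc)
  then show ?thesis
    using factor_pos[of i] by (simp add: measure_def)
qed

text \<open>By independence the mass of a smooth \<open>m\<close> is the product of the masses of its exponents, in
  which the powers of the primes recombine to \<open>m powr -s\<close>.\<close>

lemma partial_prod_law: "has_law M (partial_prod (Suc n)) (\<lambda>m. norm_const (Suc n) * smooth_weight s (Suc n) m)"
proof (rule has_lawI)
  have vimage: "partial_prod (Suc n) -` {m} \<inter> space M =
      (if smooth (Suc n) m
       then \<Inter>i\<in>{..<Suc n}. N i -` {multiplicity (nth_prime i) m} \<inter> space M else {})"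
    if "m \<ge> 1" for m
  proof -
    have "partial_prod (Suc n) \<omega> = m \<longleftrightarrow>
        smooth (Suc n) m \<and> (\<forall>i<Suc n. N i \<omega> = multiplicity (nth_prime i) m)" for \<omega>
      unfolding partial_prod_def using that by (intro prod_nth_prime_power_eq_iff) simp
    then show ?thesis by auto
  qed
  have "N i -` {j} \<inter> space M \<in> events" for i j
    by measurable
  then have "partial_prod (Suc n) -` {m} \<inter> space M \<in> events" if "m \<ge> 1" for m
    unfolding vimage[OF that] by (auto simp del: INT_simps intro!: sets.finite_INT)
  then show "partial_prod (Suc n) \<in> measurable M (count_space {1..})"
    using partial_prod_pos by (simp add: measurable_count_space_eq2_countable)
  fix m :: nat assume m: "m \<ge> 1"
  show "emeasure M (partial_prod (Suc n) -` {m} \<inter> space M) = ennreal (norm_const (Suc n) * smooth_weight s (Suc n) m)"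
  proof (cases "smooth (Suc n) m")
    case False
    with m show ?thesis by (simp add: vimage smooth_weight_def)
  next
    case True
    let ?e = "\<lambda>i. multiplicity (nth_prime i) m"
    have "prob (partial_prod (Suc n) -` {m} \<inter> space M)
        = prob (\<Inter>i\<in>{..<Suc n}. N i -` {?e i} \<inter> space M)"
      using m True by (simp add: vimage del: lessThan_Suc)
    also have "\<dots> = (\<Prod>i<Suc n. prob (N i -` {?e i} \<inter> space M))"
      by (intro indep_varsD[OF indep]) auto
    also have "\<dots> = norm_const (Suc n) * (\<Prod>i<Suc n. real (nth_prime i) powr (- (s * real (?e i))))"
      unfolding prob_N norm_const_def prod.distrib ..
    also have "(\<Prod>i<Suc n. real (nth_prime i) powr (- (s * real (?e i))))
        = (\<Prod>i<Suc n. real (nth_prime i) ^ ?e i) powr (- s)"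
      unfolding prod_powr_distrib
      by (intro prod.cong refl) (simp add: powr_powr mult.commute flip: powr_realpow)
    also have "(\<Prod>i<Suc n. real (nth_prime i) ^ ?e i) = real (\<Prod>i<Suc n. nth_prime i ^ ?e i)"
      by simp
    also have "\<dots> = real m" using smooth_decompose[OF _ True] m by simp
    finally show ?thesis
      using True by (simp add: emeasure_eq_measure smooth_weight_def)
  qed
qed

lemma integral_partial_prod:
  fixes f :: "nat \<Rightarrow> 'b::{banach, second_countable_topology}"
  assumes bd: "\<And>k. k \<ge> 1 \<Longrightarrow> norm (f k) \<le> B"
  shows "(\<integral>\<omega>. f (partial_prod (Suc n) \<omega>) \<partial>M)
    = norm_const (Suc n) *\<^sub>R (\<Sum>k. smooth_weight s (Suc n) (Suc k) *\<^sub>R f (Suc k))"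
proof -
  let ?I = "\<integral>\<omega>. f (partial_prod (Suc n) \<omega>) \<partial>M"
  have c: "norm_const (Suc n) > 0" by (rule norm_const_pos)
  then have "(\<lambda>k. (norm_const (Suc n) * smooth_weight s (Suc n) (Suc k)) *\<^sub>R f (Suc k)) sums ?I"
    by (intro has_law_integral(2)[OF partial_prod_law, where B = B] bd) auto
  from sums_scaleR_right[OF this, of "inverse (norm_const (Suc n))"]
  have "(\<lambda>k. smooth_weight s (Suc n) (Suc k) *\<^sub>R f (Suc k)) sums (inverse (norm_const (Suc n)) *\<^sub>R ?I)"
    using c by (simp add: mult.assoc[symmetric])
  then show ?thesis using c by (simp add: sums_iff)
qed

text \<open>The law of the partial product has total mass \<open>1\<close>, so the constant is the inverse of the Zeta
  series restricted to smooth numbers.\<close>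

lemma norm_const_tendsto: "norm_const \<longlonglongrightarrow> 1 / zeta s"
proof -
  let ?T = "\<lambda>n. \<Sum>k. smooth_weight s n (Suc k) *\<^sub>R (1::real)"
  have "?T \<longlonglongrightarrow> (\<Sum>k. real (Suc k) powr (- s) *\<^sub>R 1)"
    by (rule suminf_smooth_weight_tendsto[OF s_gt_1, where B = 1]) simp
  then have T: "?T \<longlonglongrightarrow> zeta s" by (simp add: zeta_def)
  have "norm_const (Suc n) * ?T (Suc n) = 1" for n
    using integral_partial_prod[of "\<lambda>_. 1::real" 1 n] by (simp add: prob_space)
  then have "norm_const (Suc n) = 1 / ?T (Suc n)" for n
    by (metis mult_zero_right nonzero_eq_divide_eq zero_neq_one)
  moreover have "(\<lambda>n. 1 / ?T (Suc n)) \<longlonglongrightarrow> 1 / zeta s"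
    using zeta_pos[OF s_gt_1] by (intro tendsto_intros LIMSEQ_Suc[OF T]) auto
  ultimately show ?thesis by (subst filterlim_sequentially_Suc[symmetric]) presburger
qed

section \<open>Euler products\<close>

lemma nn_integral_factor:
  fixes g :: "nat \<Rightarrow> ennreal"
  shows "(\<integral>\<^sup>+\<omega>. g (nth_prime i ^ N i \<omega>) \<partial>M) = ennreal (1 - real (nth_prime i) powr (- s)) *
     (\<Sum>j. ennreal (real (nth_prime i) powr (- (s * real j))) * g (nth_prime i ^ j))"
  using has_law_nn_integral[OF law[of i], of "\<lambda>k. g (nth_prime i ^ (k - 1))"] factor_pos[of i]
  by (simp add: geometric_mass_Suc ennreal_mult mult.assoc ennreal_suminf_cmult)

text \<open>Both products come from the two evaluations of the expectation of \<open>g\<close> at the partial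
  product. The constant is positive and finite, so it can be cancelled even when the series
  diverges.\<close>

lemma euler_product_ennreal:
  fixes g :: "nat \<Rightarrow> ennreal"
  assumes g: "\<And>a b. a \<ge> 1 \<Longrightarrow> b \<ge> 1 \<Longrightarrow> coprime a b \<Longrightarrow> g (a * b) = g a * g b"
  defines "T \<equiv> \<Sum>k. ennreal (real (Suc k) powr (- s)) * g (Suc k)"
  shows "infinite_product (\<lambda>i. \<integral>\<^sup>+\<omega>. g (nth_prime i ^ N i \<omega>) \<partial>M) (ennreal (1 / zeta s) * T)"
    and "infinite_product
      (\<lambda>i. \<Sum>j. ennreal (real (nth_prime i) powr (- (s * real j))) * g (nth_prime i ^ j)) T"
proof -
  let ?F = "\<lambda>i. \<Sum>j. ennreal (real (nth_prime i) powr (- (s * real j))) * g (nth_prime i ^ j)"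
  let ?E = "\<lambda>i. \<integral>\<^sup>+\<omega>. g (nth_prime i ^ N i \<omega>) \<partial>M"
  define S where "S n = (\<Sum>k. ennreal (smooth_weight s n (Suc k)) * g (Suc k))" for n
  have S: "S \<longlonglongrightarrow> T"
    unfolding S_def[abs_def] T_def by (rule suminf_smooth_weight_tendsto_ennreal)
  have E: "(\<Prod>i<Suc n. ?E i) = ennreal (norm_const (Suc n)) * S (Suc n)" for n
  proof -
    have "(\<Prod>i<Suc n. ?E i) = (\<integral>\<^sup>+\<omega>. (\<Prod>i<Suc n. g (nth_prime i ^ N i \<omega>)) \<partial>M)"
      by (intro indep_vars_nn_integral[symmetric]
          indep_vars_compose2[OF indep_vars_subset[OF indep]]) auto
    also have "\<dots> = (\<integral>\<^sup>+\<omega>. g (partial_prod (Suc n) \<omega>) \<partial>M)"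
      unfolding partial_prod_def by (subst multiplicative_prod_nth_prime[of g]) (use g in auto)
    also have "\<dots> = ennreal (norm_const (Suc n)) * S (Suc n)"
      using norm_const_pos[of "Suc n"]
      by (simp add: has_law_nn_integral[OF partial_prod_law] S_def ennreal_mult mult.assoc ennreal_suminf_cmult)
    finally show ?thesis .
  qed
  have "(\<Prod>i<n. ?E i) = ennreal (norm_const n) * (\<Prod>i<n. ?F i)" for n
    unfolding nn_integral_factor prod.distrib norm_const_def using factor_pos
    by (subst prod_ennreal) (auto intro: less_imp_le)
  then have CF: "ennreal (norm_const (Suc n)) * (\<Prod>i<Suc n. ?F i) = ennreal (norm_const (Suc n)) * S (Suc n)" for n
    unfolding E[symmetric] by (rule sym)
  then have F: "(\<Prod>i<Suc n. ?F i) = S (Suc n)" for n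
    using CF[of n] norm_const_pos[of "Suc n"] unfolding ennreal_mult_cancel_left
    by (auto simp: ennreal_eq_0_iff simp del: prod.lessThan_Suc)
  show "infinite_product ?F T"
    unfolding infinite_product_def using LIMSEQ_Suc[OF S]
    by (subst filterlim_sequentially_Suc[symmetric]) (simp only: F)
  have "(\<lambda>n. ennreal (norm_const (Suc n)) * S (Suc n)) \<longlonglongrightarrow> ennreal (1 / zeta s) * T"
    using zeta_pos[OF s_gt_1]
    by (intro tendsto_mult_ennreal tendsto_ennrealI LIMSEQ_Suc[OF S] LIMSEQ_Suc[OF norm_const_tendsto])
       (auto simp: ennreal_eq_0_iff)
  then show "infinite_product ?E (ennreal (1 / zeta s) * T)"
    unfolding infinite_product_def E[symmetric]
    by (subst filterlim_sequentially_Suc[symmetric])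
qed

lemma integral_factor:
  fixes f :: "nat \<Rightarrow> complex"
  assumes bd: "\<And>k. k \<ge> 1 \<Longrightarrow> norm (f k) \<le> B"
  shows "integrable M (\<lambda>\<omega>. f (nth_prime i ^ N i \<omega>))"
    and "summable (\<lambda>j. real (nth_prime i) powr (- (s * real j)) *\<^sub>R f (nth_prime i ^ j))"
    and "(\<integral>\<omega>. f (nth_prime i ^ N i \<omega>) \<partial>M) = (1 - real (nth_prime i) powr (- s)) *\<^sub>R
     (\<Sum>j. real (nth_prime i) powr (- (s * real j)) *\<^sub>R f (nth_prime i ^ j))"
proof -
  let ?h = "\<lambda>k. f (nth_prime i ^ (k - 1))" and ?c = "1 - real (nth_prime i) powr (- s)"
  let ?a = "\<lambda>j. real (nth_prime i) powr (- (s * real j)) *\<^sub>R f (nth_prime i ^ j)"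
  have h: "norm (?h k) \<le> B" for k
    using bd by (simp add: Suc_le_eq)
  have w: "geometric_mass ?c k \<ge> 0" for k
    using factor_pos[of i] by (simp add: geometric_mass_def)
  note L = has_law_integral[where f = ?h, OF law[of i] w h]
  show "integrable M (\<lambda>\<omega>. f (nth_prime i ^ N i \<omega>))"
    using L(1) by simp
  have "(\<lambda>j. ?c *\<^sub>R ?a j) sums (\<integral>\<omega>. f (nth_prime i ^ N i \<omega>) \<partial>M)"
    using L(2) by (simp add: geometric_mass_Suc)
  then have "(\<lambda>j. inverse ?c *\<^sub>R ?c *\<^sub>R ?a j) sums (inverse ?c *\<^sub>R (\<integral>\<omega>. f (nth_prime i ^ N i \<omega>) \<partial>M))"
    by (rule sums_scaleR_right)
  then have "?a sums (inverse ?c *\<^sub>R (\<integral>\<omega>. f (nth_prime i ^ N i \<omega>) \<partial>M))"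
    using factor_pos[of i] by (simp add: mult.assoc[symmetric])
  then show "summable ?a" "(\<integral>\<omega>. f (nth_prime i ^ N i \<omega>) \<partial>M) = ?c *\<^sub>R (\<Sum>j. ?a j)"
    using factor_pos[of i] by (auto simp: sums_iff)
qed

text \<open>The argument for \<open>[0, \<infinity>]\<close>, with boundedness in place of nonnegativity: it makes all
  expectations finite and justifies the passage to the limit.\<close>

lemma euler_product_complex:
  fixes f :: "nat \<Rightarrow> complex"
  assumes f: "\<And>a b. a \<ge> 1 \<Longrightarrow> b \<ge> 1 \<Longrightarrow> coprime a b \<Longrightarrow> f (a * b) = f a * f b"
    and bd: "\<And>k. k \<ge> 1 \<Longrightarrow> norm (f k) \<le> B"
  defines "T \<equiv> \<Sum>k. real (Suc k) powr (- s) *\<^sub>R f (Suc k)"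
  shows "infinite_product (\<lambda>i. \<integral>\<omega>. f (nth_prime i ^ N i \<omega>) \<partial>M) ((1 / zeta s) *\<^sub>R T)"
    and "infinite_product
      (\<lambda>i. \<Sum>j. real (nth_prime i) powr (- (s * real j)) *\<^sub>R f (nth_prime i ^ j)) T"
proof -
  let ?F = "\<lambda>i. \<Sum>j. real (nth_prime i) powr (- (s * real j)) *\<^sub>R f (nth_prime i ^ j)"
  let ?E = "\<lambda>i. \<integral>\<omega>. f (nth_prime i ^ N i \<omega>) \<partial>M"
  define S where "S n = (\<Sum>k. smooth_weight s n (Suc k) *\<^sub>R f (Suc k))" for n
  have S: "S \<longlonglongrightarrow> T"
    unfolding S_def[abs_def] T_def by (rule suminf_smooth_weight_tendsto[OF s_gt_1 bd])
  have E: "(\<Prod>i<Suc n. ?E i) = norm_const (Suc n) *\<^sub>R S (Suc n)" for n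
  proof -
    have "(\<Prod>i<Suc n. ?E i) = (\<integral>\<omega>. (\<Prod>i<Suc n. f (nth_prime i ^ N i \<omega>)) \<partial>M)"
      by (intro indep_vars_lebesgue_integral[symmetric] integral_factor(1)[OF bd]
          indep_vars_compose2[OF indep_vars_subset[OF indep]]) auto
    also have "\<dots> = (\<integral>\<omega>. f (partial_prod (Suc n) \<omega>) \<partial>M)"
      unfolding partial_prod_def by (subst multiplicative_prod_nth_prime[of f]) (use f in auto)
    also have "\<dots> = norm_const (Suc n) *\<^sub>R S (Suc n)"
      unfolding S_def by (rule integral_partial_prod[OF bd])
    finally show ?thesis .
  qed
  have "(\<Prod>i<n. ?E i) = norm_const n *\<^sub>R (\<Prod>i<n. ?F i)" for n
    by (simp add: integral_factor(3)[where f = f, OF bd] norm_const_def prod.distrib scaleR_conv_of_real)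
  then have CF: "norm_const (Suc n) *\<^sub>R (\<Prod>i<Suc n. ?F i) = norm_const (Suc n) *\<^sub>R S (Suc n)" for n
    unfolding E[symmetric] by (rule sym)
  then have F: "(\<Prod>i<Suc n. ?F i) = S (Suc n)" for n
    using CF[of n] norm_const_pos[of "Suc n"] unfolding scaleR_cancel_left by linarith
  show "infinite_product ?F T"
    unfolding infinite_product_def using LIMSEQ_Suc[OF S]
    by (subst filterlim_sequentially_Suc[symmetric]) (simp only: F)
  have "(\<lambda>n. norm_const (Suc n) *\<^sub>R S (Suc n)) \<longlonglongrightarrow> (1 / zeta s) *\<^sub>R T"
    by (intro tendsto_scaleR LIMSEQ_Suc[OF S] LIMSEQ_Suc[OF norm_const_tendsto])
  then show "infinite_product ?E ((1 / zeta s) *\<^sub>R T)"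
    unfolding infinite_product_def E[symmetric]
    by (subst filterlim_sequentially_Suc[symmetric])
qed

end


section \<open>Completely multiplicative functions\<close>

text \<open>The terms are at least \<open>1\<close> for \<open>x \<ge> 1\<close>; truncated subtraction then makes both sides \<open>\<infinity>\<close>.\<close>

lemma ennreal_suminf_geometric:
  assumes "x \<ge> 0"
  shows "(\<Sum>j. ennreal (x ^ j)) = inverse (1 - ennreal x)"
proof (cases "x < 1")
  case True
  then have "(\<Sum>j. ennreal (x ^ j)) = ennreal (1 / (1 - x))"
    using assms by (intro sums_unique[symmetric] sums_ennreal[THEN iffD2] geometric_sums) auto
  moreover have "1 - ennreal x = ennreal (1 - x)"
    using assms by (simp add: ennreal_minus flip: ennreal_1)
  ultimately show ?thesis
    using True by (simp add: inverse_ennreal divide_inverse)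
next
  case False
  have le: "of_nat n \<le> (\<Sum>j. ennreal (x ^ j))" for n
  proof -
    have "of_nat n = (\<Sum>j<n. 1 :: ennreal)" by simp
    also have "\<dots> \<le> (\<Sum>j<n. ennreal (x ^ j))"
      using False by (intro sum_mono) (auto simp flip: ennreal_1)
    also have "\<dots> \<le> (\<Sum>j. ennreal (x ^ j))" by (intro sum_le_suminf) auto
    finally show ?thesis .
  qed
  have "\<not> (\<Sum>j. ennreal (x ^ j)) < top"
  proof
    assume "(\<Sum>j. ennreal (x ^ j)) < top"
    then obtain n where "(\<Sum>j. ennreal (x ^ j)) < of_nat n"
      using ennreal_Ex_less_of_nat by blast
    with le[of n] show False by simp
  qed
  then have "(\<Sum>j. ennreal (x ^ j)) = top" by (metis top.not_eq_extremum)
  moreover have "1 - ennreal x = 0"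
    using False by (simp add: diff_eq_0_iff_ennreal flip: ennreal_1)
  ultimately show ?thesis by simp
qed

text \<open>A point where \<open>f\<close> does not vanish forces \<open>f 1 = 1\<close>, which is the case \<open>j = 0\<close>.\<close>

lemma completely_multiplicative_power:
  assumes f: "completely_multiplicative_fun f" and n: "n \<ge> 1" "f n \<noteq> 0" and p: "p \<ge> 1"
  shows "f (p ^ j) = f p ^ j"
proof (induction j)
  case 0
  have "f (n * 1) = f n * f 1"
    using f n unfolding completely_multiplicative_fun_def by blast
  then show ?case using n by simp
next
  case (Suc j)
  have "f (p * p ^ j) = f p * f (p ^ j)"
    using f p unfolding completely_multiplicative_fun_def by simp
  then show ?case using Suc by simp
qed

lemma norm_le_1_if_powers_bounded:
  fixes z :: "'b::real_normed_div_algebra"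
  assumes "\<And>j. norm (z ^ j) \<le> B"
  shows "norm z \<le> 1"
proof (rule ccontr)
  assume "\<not> norm z \<le> 1"
  then obtain j where "B < norm z ^ j" using real_arch_pow[of "norm z" B] by auto
  with assms[of j] show False by (simp add: norm_power)
qed

section \<open>The product formulas for the Zeta law\<close>

theorem mainTheorem2:
  fixes s :: real and \<phi> :: "nat \<Rightarrow> complex"
    and M :: "'a measure" and X :: "'a \<Rightarrow> nat" and N :: "nat \<Rightarrow> 'a \<Rightarrow> nat"
  assumes "s > 1"
    and "multiplicative_fun \<phi>"
    and "nonnegative_fun \<phi> \<or> bounded_fun \<phi>"
    and "prob_space M"
    and "has_law M X (zeta_mass s)"
    and "prob_space.indep_vars M (\<lambda>_. count_space UNIV) N UNIV"
    and "\<And>i. has_law M (\<lambda>\<omega>. 1 + N i \<omega>) (geometric_mass (1 - real (nth_prime i) powr (- s)))"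
  shows
   "(nonnegative_fun \<phi> \<longrightarrow>
       infinite_product (\<lambda>i. \<integral>\<^sup>+\<omega>. ennreal (Re (\<phi> (nth_prime i ^ N i \<omega>))) \<partial>M)
         (\<integral>\<^sup>+\<omega>. ennreal (Re (\<phi> (X \<omega>))) \<partial>M)
     \<and> infinite_product
         (\<lambda>i. \<Sum>j. ennreal (real (nth_prime i) powr (- (s * real j)) * Re (\<phi> (nth_prime i ^ j))))
         (\<Sum>n. ennreal (Re (\<phi> (Suc n)) / real (Suc n) powr s))
     \<and> (completely_multiplicative_fun \<phi> \<and> (\<exists>n\<ge>1. \<phi> n \<noteq> 0) \<longrightarrow>
         infinite_product
           (\<lambda>i. inverse (1 - ennreal (real (nth_prime i) powr (- s) * Re (\<phi> (nth_prime i)))))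
           (\<Sum>n. ennreal (Re (\<phi> (Suc n)) / real (Suc n) powr s))))
  \<and> (bounded_fun \<phi> \<longrightarrow>
       integrable M (\<lambda>\<omega>. \<phi> (X \<omega>))
     \<and> (\<forall>i. integrable M (\<lambda>\<omega>. \<phi> (nth_prime i ^ N i \<omega>)))
     \<and> infinite_product (\<lambda>i. \<integral>\<omega>. \<phi> (nth_prime i ^ N i \<omega>) \<partial>M) (\<integral>\<omega>. \<phi> (X \<omega>) \<partial>M)
     \<and> summable (\<lambda>n. \<phi> (Suc n) / of_real (real (Suc n) powr s))
     \<and> (\<forall>i. summable (\<lambda>j. of_real (real (nth_prime i) powr (- (s * real j))) * \<phi> (nth_prime i ^ j)))
     \<and> infinite_product
         (\<lambda>i. \<Sum>j. of_real (real (nth_prime i) powr (- (s * real j))) * \<phi> (nth_prime i ^ j))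
         (\<Sum>n. \<phi> (Suc n) / of_real (real (Suc n) powr s))
     \<and> (completely_multiplicative_fun \<phi> \<and> (\<exists>n\<ge>1. \<phi> n \<noteq> 0) \<longrightarrow>
         (\<forall>i. 1 - of_real (real (nth_prime i) powr (- s)) * \<phi> (nth_prime i) \<noteq> 0)
       \<and> infinite_product
           (\<lambda>i. inverse (1 - of_real (real (nth_prime i) powr (- s)) * \<phi> (nth_prime i)))
           (\<Sum>n. \<phi> (Suc n) / of_real (real (Suc n) powr s))))"
proof -
  interpret prob_space M by fact
  interpret zeta_exponents M s N
    by unfold_locales (use assms in auto)
  have mult: "\<phi> (a * b) = \<phi> a * \<phi> b" if "a \<ge> 1" "b \<ge> 1" "coprime a b" for a b
    using assms(2) that unfolding multiplicative_fun_def by blast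
  have zeta_mass: "zeta_mass s k = (1 / zeta s) * real k powr (- s)" for k
    by (simp add: zeta_mass_def)
  have zeta_mass_nonneg: "zeta_mass s k \<ge> 0" for k
    using zeta_pos[OF s_gt_1] by (simp add: zeta_mass)
  have p1: "nth_prime i ^ j \<ge> 1" for i j by (simp add: Suc_le_eq)
  let ?x = "\<lambda>i. real (nth_prime i) powr (- s)"
  show ?thesis
  proof (intro conjI impI)
    assume nn: "nonnegative_fun \<phi>"
    define g where "g n = ennreal (Re (\<phi> n))" for n
    have Re_nn: "Re (\<phi> n) \<ge> 0" and Im_0: "Im (\<phi> n) = 0" if "n \<ge> 1" for n
      using nn that by (auto simp: nonnegative_fun_def complex_nonneg_Reals_iff)
    have g: "g (a * b) = g a * g b" if "a \<ge> 1" "b \<ge> 1" "coprime a b" for a b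
      using that by (simp add: g_def mult Im_0 Re_nn ennreal_mult)
    let ?T = "\<Sum>n. ennreal (Re (\<phi> (Suc n)) / real (Suc n) powr s)"
    have T: "(\<Sum>k. ennreal (real (Suc k) powr (- s)) * g (Suc k)) = ?T"
    proof (rule suminf_cong)
      fix k
      have "Re (\<phi> (Suc k)) / real (Suc k) powr s = real (Suc k) powr (- s) * Re (\<phi> (Suc k))"
        by (simp add: powr_minus field_simps)
      then show "ennreal (real (Suc k) powr (- s)) * g (Suc k) = ennreal (Re (\<phi> (Suc k)) / real (Suc k) powr s)"
        using Re_nn[of "Suc k"] by (simp only: g_def ennreal_mult powr_ge_zero)
    qed
    have X: "(\<integral>\<^sup>+\<omega>. g (X \<omega>) \<partial>M) = ennreal (1 / zeta s) * ?T"
    proof -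
      have "(\<integral>\<^sup>+\<omega>. g (X \<omega>) \<partial>M) = (\<Sum>k. ennreal (1 / zeta s) * (ennreal (real (Suc k) powr (- s)) * g (Suc k)))"
        unfolding has_law_nn_integral[OF assms(5)] zeta_mass using zeta_pos[OF s_gt_1]
        by (subst ennreal_mult) (auto simp: mult.assoc)
      then show ?thesis unfolding ennreal_suminf_cmult T .
    qed
    have F: "(\<Sum>j. ennreal (real (nth_prime i) powr (- (s * real j))) * g (nth_prime i ^ j))
        = (\<Sum>j. ennreal (real (nth_prime i) powr (- (s * real j)) * Re (\<phi> (nth_prime i ^ j))))" for i
      using Re_nn[OF p1] by (intro suminf_cong) (simp add: g_def ennreal_mult)
    show "infinite_product (\<lambda>i. \<integral>\<^sup>+\<omega>. ennreal (Re (\<phi> (nth_prime i ^ N i \<omega>))) \<partial>M)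
         (\<integral>\<^sup>+\<omega>. ennreal (Re (\<phi> (X \<omega>))) \<partial>M)"
      using euler_product_ennreal(1)[of g, OF g] unfolding T X[symmetric] by (simp only: g_def)
    show prod: "infinite_product
         (\<lambda>i. \<Sum>j. ennreal (real (nth_prime i) powr (- (s * real j)) * Re (\<phi> (nth_prime i ^ j)))) ?T"
      using euler_product_ennreal(2)[of g, OF g] unfolding T F .
    assume "completely_multiplicative_fun \<phi> \<and> (\<exists>n\<ge>1. \<phi> n \<noteq> 0)"
    then have pow: "\<phi> (nth_prime i ^ j) = \<phi> (nth_prime i) ^ j" for i j
      using p1[of i 1] by (auto intro: completely_multiplicative_power)
    have Re_pow: "Re (\<phi> (nth_prime i) ^ j) = Re (\<phi> (nth_prime i)) ^ j" for i j
    proof -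
      have "\<phi> (nth_prime i) = of_real (Re (\<phi> (nth_prime i)))"
        using Im_0[OF p1[of i 1]] by (simp add: complex_eq_iff)
      then show ?thesis by (metis Re_complex_of_real of_real_power)
    qed
    have "(\<Sum>j. ennreal (real (nth_prime i) powr (- (s * real j)) * Re (\<phi> (nth_prime i ^ j))))
        = inverse (1 - ennreal (?x i * Re (\<phi> (nth_prime i))))" for i
      using Re_nn[OF p1[of i 1]]
      by (simp add: pow Re_pow powr_mult_nat flip: power_mult_distrib ennreal_suminf_geometric)
    with prod show "infinite_product
           (\<lambda>i. inverse (1 - ennreal (?x i * Re (\<phi> (nth_prime i))))) ?T"
      by simp
  next
    assume "bounded_fun \<phi>"
    then obtain B where bd: "\<And>k. k \<ge> 1 \<Longrightarrow> norm (\<phi> k) \<le> B"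
      by (auto simp: bounded_fun_def bounded_iff)
    let ?T = "\<Sum>n. \<phi> (Suc n) / of_real (real (Suc n) powr s)"
    have T: "real (Suc k) powr (- s) *\<^sub>R \<phi> (Suc k) = \<phi> (Suc k) / of_real (real (Suc k) powr s)" for k
      unfolding powr_minus by (simp add: scaleR_conv_of_real field_simps del: of_nat_Suc)
    note X = has_law_integral[where f = \<phi>, OF assms(5) zeta_mass_nonneg bd]
    show "integrable M (\<lambda>\<omega>. \<phi> (X \<omega>))" by (rule X(1))
    show sum: "summable (\<lambda>n. \<phi> (Suc n) / of_real (real (Suc n) powr s))"
      using suminf_smooth_weight_tendsto(1)[where f = \<phi>, OF s_gt_1 bd] unfolding T .
    have EX: "(\<integral>\<omega>. \<phi> (X \<omega>) \<partial>M) = (1 / zeta s) *\<^sub>R ?T"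
    proof -
      have "(\<lambda>k. (1 / zeta s) *\<^sub>R (\<phi> (Suc k) / of_real (real (Suc k) powr s))) sums (\<integral>\<omega>. \<phi> (X \<omega>) \<partial>M)"
        using X(2) unfolding zeta_mass scaleR_scaleR[symmetric] T .
      moreover have "(\<lambda>k. (1 / zeta s) *\<^sub>R (\<phi> (Suc k) / of_real (real (Suc k) powr s)))
          sums ((1 / zeta s) *\<^sub>R ?T)"
        by (intro sums_scaleR_right summable_sums sum)
      ultimately show ?thesis by (rule sums_unique2)
    qed
    show "\<forall>i. integrable M (\<lambda>\<omega>. \<phi> (nth_prime i ^ N i \<omega>))"
      using integral_factor(1)[where f = \<phi>, OF bd] by blast
    show "infinite_product (\<lambda>i. \<integral>\<omega>. \<phi> (nth_prime i ^ N i \<omega>) \<partial>M) (\<integral>\<omega>. \<phi> (X \<omega>) \<partial>M)"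
      using euler_product_complex(1)[where f = \<phi>, OF mult bd] unfolding T EX .
    show "\<forall>i. summable (\<lambda>j. of_real (real (nth_prime i) powr (- (s * real j))) * \<phi> (nth_prime i ^ j))"
      using integral_factor(2)[where f = \<phi>, OF bd] unfolding scaleR_conv_of_real by blast
    show prod: "infinite_product
         (\<lambda>i. \<Sum>j. of_real (real (nth_prime i) powr (- (s * real j))) * \<phi> (nth_prime i ^ j)) ?T"
      using euler_product_complex(2)[where f = \<phi>, OF mult bd]
      unfolding T unfolding scaleR_conv_of_real .
    assume "completely_multiplicative_fun \<phi> \<and> (\<exists>n\<ge>1. \<phi> n \<noteq> 0)"
    then have pow: "\<phi> (nth_prime i ^ j) = \<phi> (nth_prime i) ^ j" for i j
      using p1[of i 1] by (auto intro: completely_multiplicative_power)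
    \<comment> \<open>all powers of \<open>\<phi> p\<close> are values of \<open>\<phi>\<close>, so boundedness puts \<open>\<phi> p\<close> in the unit disc\<close>
    have small: "norm (of_real (?x i) * \<phi> (nth_prime i)) < 1" for i
    proof -
      have "norm (\<phi> (nth_prime i)) \<le> 1"
        using bd[OF p1[of i]] unfolding pow by (rule norm_le_1_if_powers_bounded)
      then have "?x i * norm (\<phi> (nth_prime i)) \<le> ?x i * 1"
        by (intro mult_left_mono) auto
      also have "\<dots> < 1"
        using nth_prime_powr_bounds[OF s_gt_1, of i] by simp
      finally show ?thesis by (simp add: norm_mult)
    qed
    show "\<forall>i. 1 - of_real (?x i) * \<phi> (nth_prime i) \<noteq> 0"
    proof
      fix i
      show "1 - of_real (?x i) * \<phi> (nth_prime i) \<noteq> 0"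
        using small[of i] by (metis eq_iff_diff_eq_0 less_irrefl norm_one)
    qed
    have "(\<Sum>j. of_real (real (nth_prime i) powr (- (s * real j))) * \<phi> (nth_prime i ^ j))
        = inverse (1 - of_real (?x i) * \<phi> (nth_prime i))" for i
      using suminf_geometric[OF small[of i]]
      by (simp add: pow powr_mult_nat power_mult_distrib inverse_eq_divide)
    with prod show "infinite_product (\<lambda>i. inverse (1 - of_real (?x i) * \<phi> (nth_prime i))) ?T"
      by simp
  qed
qed

end
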